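(* Let $\Delta$ be a finite domain and $\mathcal C=\{(\alpha_1,q_1),\ldots,(\alpha_k,q_k)\}$ a finite set of pairs with $\alpha_i$ a quantified sentence and $q_i\in[0,1]$. Let $\mathcal C_H=\{\alpha\mid(\alpha,1)\in\mathcal C\}\cup\{\operatorname{neg}(\alpha)\mid(\alpha,0)\in\mathcal C\}$, $\mathcal C_S=\{(\alpha,q)\in\mathcal C\mid 0<q<1\}$, and $\Omega=\{\omega\in\Omega(\sigma,\Delta)\mid Q_\omega(\alpha)=1\text{ for all }\alpha\in\mathcal C_H\}$. Consider the maximum entropy relational marginal problem: maximize $\sum_{\omega\in\Omega}P_\omega\log\frac1{P_\omega}$ over real vectors $(P_\omega)_{\omega\in\Omega}$ subject to $\sum_{\omega\in\Omega}Q_\omega(\alpha_i)\,P_\omega=q_i$ for all $(\alpha_i,q_i)\in\mathcal C_S$, $P_\omega\ge0$ for all $\omega\in\Omega$, and $\sum_{\omega\in\Omega}P_\omega=1$. Assume there is a feasible solution with $P_\omega>0$ for all $\omega\in\Omega$. Then there are real weights $w_i$ (one for each $(\alpha_i,q_i)\in\mathcal C_S$) that maximize $$\sum_{(\alpha_i,q_i)\in\mathcal C_S}w_iq_i-\log\left(\sum_{\omega\in\Omega}\exp\left(\sum_{(\alpha_i,q_i)\in\mathcal C_S}w_i\cdot Q_\omega(\alpha_i)\right)\right),$$ and with such weights the maximum entropy problem is solved by $$P_\omega=\frac1Z\exp\left(\sum_{(\alpha_i,q_i)\in\mathcal C_S}w_i\cdot Q_\omega(\alpha_i)\right)\qquad(\omega\in\Omega),$$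 where $Z$ is the normalization constant.
   Context: First-order logic (FOL) is function-free with a finite set $\mathbf C$ of constants; $\sigma$ is a finite set of predicate names with arities, containing all predicate names used in the formulas. A domain $\Delta$ is a finite nonempty set with $\mathbf C\subseteq\Delta$ (each constant denotes itself). $\Omega(\sigma,\Delta)$ is the set of all $\sigma$-structures over $\Delta$, called possible worlds. Convention: $0\log\frac10=0$. A quantified sentence is $\alpha=Q_1x_1\ldots Q_nx_n\colon\varphi(x_1,\ldots,x_n)$ with $Q_i\in\{\forall,\exists,\forall^*\}$ and $\varphi$ an FOL formula with free variables precisely $x_1,\ldots,x_n$. Its negation is $\operatorname{neg}(\alpha)=\overline{Q_1}x_1\ldots\overline{Q_n}x_n\colon\neg\varphi(x_1,\ldots,x_n)$, where $\overline\exists=\forall$, $\overline\forall=\exists$, $\overline{\forall^*}=\forall^*$. The statistic $Q_\omega(\alpha)$ in a world $\omega$ is defined recursively: if $\alpha$ is an FOL sentence (contains no $\forall^*$), $Q_\omega(\alpha)=1$ if $\omega\models\alpha$ and $0$ otherwise; otherwise $Q_\omega(\forall x\colon\alpha')=\min_{a\in\Delta}Q_\omega(\alpha'[x/a])$, $Q_\omega(\exists x\colon\alpha')=\max_{a\in\Delta}Q_\omega(\alpha'[x/a])$, $Q_\omega(\forall^* x\colon\alpha')=\frac1{|\Delta|}\sum_{a\in\Delta}Q_\omega(\alpha'[x/a])$. *)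

theory Defs
  imports Complex_Main
begin

section \<open>Function-free first-order logic\<close>

text \<open>Domain elements serve as constant symbols denoting themselves, so substituting a domain
  element for a variable yields a formula again. The constants that may occur in the formulas one
  starts from are restricted by \<open>wf_fm\<close> below.\<close>

datatype 'a trm = Var nat | Const 'a

datatype ('p, 'a) fm =
    Atom 'p "'a trm list"
  | Eq "'a trm" "'a trm"
  | Neg "('p, 'a) fm"
  | Conj "('p, 'a) fm" "('p, 'a) fm"
  | Disj "('p, 'a) fm" "('p, 'a) fm"
  | Impl "('p, 'a) fm" "('p, 'a) fm"
  | Forall nat "('p, 'a) fm"
  | Exists nat "('p, 'a) fm"

primrec fv_trm :: "'a trm \<Rightarrow> nat set" where
  "fv_trm (Var x) = {x}"
| "fv_trm (Const c) = {}"

primrec fv :: "('p, 'a) fm \<Rightarrow> nat set" where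
  "fv (Atom p ts) = (\<Union>t\<in>set ts. fv_trm t)"
| "fv (Eq s t) = fv_trm s \<union> fv_trm t"
| "fv (Neg \<phi>) = fv \<phi>"
| "fv (Conj \<phi> \<psi>) = fv \<phi> \<union> fv \<psi>"
| "fv (Disj \<phi> \<psi>) = fv \<phi> \<union> fv \<psi>"
| "fv (Impl \<phi> \<psi>) = fv \<phi> \<union> fv \<psi>"
| "fv (Forall x \<phi>) = fv \<phi> - {x}"
| "fv (Exists x \<phi>) = fv \<phi> - {x}"

primrec wf_trm :: "'a set \<Rightarrow> 'a trm \<Rightarrow> bool" where
  "wf_trm Cs (Var x) \<longleftrightarrow> True"
| "wf_trm Cs (Const c) \<longleftrightarrow> c \<in> Cs"

primrec wf_fm :: "'p set \<Rightarrow> ('p \<Rightarrow> nat) \<Rightarrow> 'a set \<Rightarrow> ('p, 'a) fm \<Rightarrow> bool" where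
  "wf_fm \<sigma> ar Cs (Atom p ts) \<longleftrightarrow> p \<in> \<sigma> \<and> length ts = ar p \<and> (\<forall>t\<in>set ts. wf_trm Cs t)"
| "wf_fm \<sigma> ar Cs (Eq s t) \<longleftrightarrow> wf_trm Cs s \<and> wf_trm Cs t"
| "wf_fm \<sigma> ar Cs (Neg \<phi>) \<longleftrightarrow> wf_fm \<sigma> ar Cs \<phi>"
| "wf_fm \<sigma> ar Cs (Conj \<phi> \<psi>) \<longleftrightarrow> wf_fm \<sigma> ar Cs \<phi> \<and> wf_fm \<sigma> ar Cs \<psi>"
| "wf_fm \<sigma> ar Cs (Disj \<phi> \<psi>) \<longleftrightarrow> wf_fm \<sigma> ar Cs \<phi> \<and> wf_fm \<sigma> ar Cs \<psi>"
| "wf_fm \<sigma> ar Cs (Impl \<phi> \<psi>) \<longleftrightarrow> wf_fm \<sigma> ar Cs \<phi> \<and> wf_fm \<sigma> ar Cs \<psi>"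
| "wf_fm \<sigma> ar Cs (Forall x \<phi>) \<longleftrightarrow> wf_fm \<sigma> ar Cs \<phi>"
| "wf_fm \<sigma> ar Cs (Exists x \<phi>) \<longleftrightarrow> wf_fm \<sigma> ar Cs \<phi>"

primrec subst_trm :: "nat \<Rightarrow> 'a \<Rightarrow> 'a trm \<Rightarrow> 'a trm" where
  "subst_trm x a (Var y) = (if y = x then Const a else Var y)"
| "subst_trm x a (Const c) = Const c"

primrec subst_fm :: "nat \<Rightarrow> 'a \<Rightarrow> ('p, 'a) fm \<Rightarrow> ('p, 'a) fm" where
  "subst_fm x a (Atom p ts) = Atom p (map (subst_trm x a) ts)"
| "subst_fm x a (Eq s t) = Eq (subst_trm x a s) (subst_trm x a t)"
| "subst_fm x a (Neg \<phi>) = Neg (subst_fm x a \<phi>)"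
| "subst_fm x a (Conj \<phi> \<psi>) = Conj (subst_fm x a \<phi>) (subst_fm x a \<psi>)"
| "subst_fm x a (Disj \<phi> \<psi>) = Disj (subst_fm x a \<phi>) (subst_fm x a \<psi>)"
| "subst_fm x a (Impl \<phi> \<psi>) = Impl (subst_fm x a \<phi>) (subst_fm x a \<psi>)"
| "subst_fm x a (Forall y \<phi>) = Forall y (if y = x then \<phi> else subst_fm x a \<phi>)"
| "subst_fm x a (Exists y \<phi>) = Exists y (if y = x then \<phi> else subst_fm x a \<phi>)"

text \<open>A structure over a domain is identified with the set of ground atoms true in it.\<close>

type_synonym ('p, 'a) world = "('p \<times> 'a list) set"

definition worlds :: "'p set \<Rightarrow> ('p \<Rightarrow> nat) \<Rightarrow> 'a set \<Rightarrow> ('p, 'a) world set" where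
  "worlds \<sigma> ar \<Delta> = Pow {(p, as). p \<in> \<sigma> \<and> length as = ar p \<and> set as \<subseteq> \<Delta>}"

primrec eval_trm :: "(nat \<Rightarrow> 'a) \<Rightarrow> 'a trm \<Rightarrow> 'a" where
  "eval_trm e (Var x) = e x"
| "eval_trm e (Const c) = c"

primrec sat :: "'a set \<Rightarrow> ('p, 'a) world \<Rightarrow> (nat \<Rightarrow> 'a) \<Rightarrow> ('p, 'a) fm \<Rightarrow> bool" where
  "sat \<Delta> \<omega> e (Atom p ts) \<longleftrightarrow> (p, map (eval_trm e) ts) \<in> \<omega>"
| "sat \<Delta> \<omega> e (Eq s t) \<longleftrightarrow> eval_trm e s = eval_trm e t"
| "sat \<Delta> \<omega> e (Neg \<phi>) \<longleftrightarrow> \<not> sat \<Delta> \<omega> e \<phi>"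
| "sat \<Delta> \<omega> e (Conj \<phi> \<psi>) \<longleftrightarrow> sat \<Delta> \<omega> e \<phi> \<and> sat \<Delta> \<omega> e \<psi>"
| "sat \<Delta> \<omega> e (Disj \<phi> \<psi>) \<longleftrightarrow> sat \<Delta> \<omega> e \<phi> \<or> sat \<Delta> \<omega> e \<psi>"
| "sat \<Delta> \<omega> e (Impl \<phi> \<psi>) \<longleftrightarrow> (sat \<Delta> \<omega> e \<phi> \<longrightarrow> sat \<Delta> \<omega> e \<psi>)"
| "sat \<Delta> \<omega> e (Forall x \<phi>) \<longleftrightarrow> (\<forall>a\<in>\<Delta>. sat \<Delta> \<omega> (e(x := a)) \<phi>)"
| "sat \<Delta> \<omega> e (Exists x \<phi>) \<longleftrightarrow> (\<exists>a\<in>\<Delta>. sat \<Delta> \<omega> (e(x := a)) \<phi>)"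

definition models :: "'a set \<Rightarrow> ('p, 'a) world \<Rightarrow> ('p, 'a) fm \<Rightarrow> bool" where
  "models \<Delta> \<omega> \<phi> \<longleftrightarrow> (\<forall>e. range e \<subseteq> \<Delta> \<longrightarrow> sat \<Delta> \<omega> e \<phi>)"

section \<open>Quantified sentences and their statistics\<close>

text \<open>\<open>Q\<^sub>1 x\<^sub>1 \<dots> Q\<^sub>n x\<^sub>n: \<phi>\<close> is \<open>Quant Q\<^sub>1 x\<^sub>1 (\<dots> (Quant Q\<^sub>n x\<^sub>n (Matrix \<phi>)))\<close>;
  \<open>QStat\<close> is the statistical quantifier \<open>\<forall>\<^sup>*\<close>.\<close>

datatype quantifier = QAll | QEx | QStat

datatype ('p, 'a) qsent = Matrix "('p, 'a) fm" | Quant quantifier nat "('p, 'a) qsent"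

primrec matrix :: "('p, 'a) qsent \<Rightarrow> ('p, 'a) fm" where
  "matrix (Matrix \<phi>) = \<phi>"
| "matrix (Quant q x \<alpha>) = matrix \<alpha>"

primrec prefix_vars :: "('p, 'a) qsent \<Rightarrow> nat list" where
  "prefix_vars (Matrix \<phi>) = []"
| "prefix_vars (Quant q x \<alpha>) = x # prefix_vars \<alpha>"

definition quantified_sentence ::
    "'p set \<Rightarrow> ('p \<Rightarrow> nat) \<Rightarrow> 'a set \<Rightarrow> ('p, 'a) qsent \<Rightarrow> bool" where
  "quantified_sentence \<sigma> ar Cs \<alpha> \<longleftrightarrow>
     wf_fm \<sigma> ar Cs (matrix \<alpha>) \<and> distinct (prefix_vars \<alpha>) \<and> fv (matrix \<alpha>) = set (prefix_vars \<alpha>)"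

primrec dual_quantifier :: "quantifier \<Rightarrow> quantifier" where
  "dual_quantifier QAll = QEx"
| "dual_quantifier QEx = QAll"
| "dual_quantifier QStat = QStat"

primrec neg :: "('p, 'a) qsent \<Rightarrow> ('p, 'a) qsent" where
  "neg (Matrix \<phi>) = Matrix (Neg \<phi>)"
| "neg (Quant q x \<alpha>) = Quant (dual_quantifier q) x (neg \<alpha>)"

primrec subst :: "nat \<Rightarrow> 'a \<Rightarrow> ('p, 'a) qsent \<Rightarrow> ('p, 'a) qsent" where
  "subst x a (Matrix \<phi>) = Matrix (subst_fm x a \<phi>)"
| "subst x a (Quant q y \<alpha>) = Quant q y (if y = x then \<alpha> else subst x a \<alpha>)"

primrec is_fol :: "('p, 'a) qsent \<Rightarrow> bool" where
  "is_fol (Matrix \<phi>) \<longleftrightarrow> True"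
| "is_fol (Quant q x \<alpha>) \<longleftrightarrow> q \<noteq> QStat \<and> is_fol \<alpha>"

text \<open>Only meaningful under \<open>is_fol\<close>; the equation for \<open>QStat\<close> is a dummy.\<close>

fun fol_of :: "('p, 'a) qsent \<Rightarrow> ('p, 'a) fm" where
  "fol_of (Matrix \<phi>) = \<phi>"
| "fol_of (Quant QAll x \<alpha>) = Forall x (fol_of \<alpha>)"
| "fol_of (Quant QEx x \<alpha>) = Exists x (fol_of \<alpha>)"
| "fol_of (Quant QStat x \<alpha>) = fol_of \<alpha>"

lemma length_prefix_vars_subst [simp]:
  "length (prefix_vars (subst x a \<alpha>)) = length (prefix_vars \<alpha>)"
  by (induction \<alpha>) auto

function stat :: "'a set \<Rightarrow> ('p, 'a) world \<Rightarrow> ('p, 'a) qsent \<Rightarrow> real" where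
  "stat \<Delta> \<omega> (Matrix \<phi>) = (if models \<Delta> \<omega> \<phi> then 1 else 0)"
| "stat \<Delta> \<omega> (Quant q x \<alpha>) =
     (if is_fol (Quant q x \<alpha>) then (if models \<Delta> \<omega> (fol_of (Quant q x \<alpha>)) then 1 else 0)
      else (case q of
          QAll \<Rightarrow> Min ((\<lambda>a. stat \<Delta> \<omega> (subst x a \<alpha>)) ` \<Delta>)
        | QEx \<Rightarrow> Max ((\<lambda>a. stat \<Delta> \<omega> (subst x a \<alpha>)) ` \<Delta>)
        | QStat \<Rightarrow> (1 / real (card \<Delta>)) * (\<Sum>a\<in>\<Delta>. stat \<Delta> \<omega> (subst x a \<alpha>))))"
  by pat_completeness auto
termination
  by (relation "measure (\<lambda>(\<Delta>, \<omega>, \<alpha>). length (prefix_vars \<alpha>))") auto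

section \<open>Maximum entropy relational marginal problem\<close>

type_synonym ('p, 'a) constr = "('p, 'a) qsent \<times> real"

definition hard :: "('p, 'a) constr set \<Rightarrow> ('p, 'a) qsent set" where
  "hard C = {\<alpha>. (\<alpha>, 1) \<in> C} \<union> {neg \<alpha> | \<alpha>. (\<alpha>, 0) \<in> C}"

definition soft :: "('p, 'a) constr set \<Rightarrow> ('p, 'a) constr set" where
  "soft C = {(\<alpha>, q) \<in> C. 0 < q \<and> q < 1}"

definition admissible_worlds ::
    "'p set \<Rightarrow> ('p \<Rightarrow> nat) \<Rightarrow> 'a set \<Rightarrow> ('p, 'a) constr set \<Rightarrow> ('p, 'a) world set" where
  "admissible_worlds \<sigma> ar \<Delta> C = {\<omega> \<in> worlds \<sigma> ar \<Delta>. \<forall>\<alpha>\<in>hard C. stat \<Delta> \<omega> \<alpha> = 1}"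

definition feasible ::
    "'a set \<Rightarrow> ('p, 'a) constr set \<Rightarrow> ('p, 'a) world set \<Rightarrow> (('p, 'a) world \<Rightarrow> real) \<Rightarrow> bool" where
  "feasible \<Delta> C \<Omega> P \<longleftrightarrow>
     (\<forall>(\<alpha>, q)\<in>soft C. (\<Sum>\<omega>\<in>\<Omega>. stat \<Delta> \<omega> \<alpha> * P \<omega>) = q) \<and>
     (\<forall>\<omega>\<in>\<Omega>. P \<omega> \<ge> 0) \<and> (\<Sum>\<omega>\<in>\<Omega>. P \<omega>) = 1"

text \<open>Terms with \<open>P \<omega> = 0\<close> vanish, matching the convention \<open>0 log (1/0) = 0\<close>.\<close>

definition entropy :: "('p, 'a) world set \<Rightarrow> (('p, 'a) world \<Rightarrow> real) \<Rightarrow> real" where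
  "entropy \<Omega> P = (\<Sum>\<omega>\<in>\<Omega>. P \<omega> * ln (1 / P \<omega>))"

definition weighted_stat ::
    "'a set \<Rightarrow> ('p, 'a) constr set \<Rightarrow> (('p, 'a) constr \<Rightarrow> real) \<Rightarrow> ('p, 'a) world \<Rightarrow> real" where
  "weighted_stat \<Delta> C w \<omega> = (\<Sum>(\<alpha>, q)\<in>soft C. w (\<alpha>, q) * stat \<Delta> \<omega> \<alpha>)"

definition weight_objective ::
    "'a set \<Rightarrow> ('p, 'a) constr set \<Rightarrow> ('p, 'a) world set \<Rightarrow> (('p, 'a) constr \<Rightarrow> real) \<Rightarrow> real" where
  "weight_objective \<Delta> C \<Omega> w =
     (\<Sum>(\<alpha>, q)\<in>soft C. w (\<alpha>, q) * q) - ln (\<Sum>\<omega>\<in>\<Omega>. exp (weighted_stat \<Delta> C w \<omega>))"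

definition exponential_distribution ::
    "'a set \<Rightarrow> ('p, 'a) constr set \<Rightarrow> ('p, 'a) world set \<Rightarrow> (('p, 'a) constr \<Rightarrow> real) \<Rightarrow>
     ('p, 'a) world \<Rightarrow> real" where
  "exponential_distribution \<Delta> C \<Omega> w \<omega> =
     (let Z = (\<Sum>\<omega>'\<in>\<Omega>. exp (weighted_stat \<Delta> C w \<omega>'))
      in 1 / Z * exp (weighted_stat \<Delta> C w \<omega>))"

end

(* The dual objective depends on the weights only through u = (SUM i. w i * (f i - q i)), whose mean
   under the strictly positive feasible P vanishes. So where SUM exp u is at most a given constant,
   u is bounded above, hence also bounded below, because the mean is zero and P is positive.
   The attainable u form a finite-dimensional and therefore closed space of functions, so a limit
   point of a maximizing sequence is attained. At a maximizer the partial derivatives vanish, which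
   says that the exponential distribution is feasible; Gibbs' inequality then makes it entropy-maximal. *)

theory Submission
  imports Defs "HOL-Analysis.Analysis"
begin

section \<open>Compactness and closedness in finite-dimensional function spaces\<close>

lemma Bseq_pointwise_convergent_subseq:
  fixes u :: "nat \<Rightarrow> 'x \<Rightarrow> real"
  assumes "finite X" and "\<And>x. x \<in> X \<Longrightarrow> Bseq (\<lambda>n. u n x)"
  shows "\<exists>r l. strict_mono r \<and> (\<forall>x\<in>X. (\<lambda>n. u (r n) x) \<longlonglongrightarrow> l x)"
  using assms
proof (induction X rule: finite_induct)
  case empty
  show ?case using strict_mono_id by auto
next
  case (insert a X)
  then obtain r l where r: "strict_mono r" "\<And>x. x \<in> X \<Longrightarrow> (\<lambda>n. u (r n) x) \<longlonglongrightarrow> l x"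
    by auto
  have "Bseq (\<lambda>n. u (r n) a)"
    using insert.prems[of a] by (auto simp: Bseq_def)
  then have "bounded (range (\<lambda>n. u (r n) a))"
    by (simp add: Bseq_eq_bounded)
  then obtain la r' where r': "strict_mono (r' :: nat \<Rightarrow> nat)"
      and la: "((\<lambda>n. u (r n) a) \<circ> r') \<longlonglongrightarrow> la"
    using bounded_imp_convergent_subsequence by blast
  have "(\<lambda>n. u ((r \<circ> r') n) x) \<longlonglongrightarrow> (l(a := la)) x" if "x \<in> insert a X" for x
  proof (cases "x = a")
    case True
    then show ?thesis using la by (simp add: o_def)
  next
    case False
    then show ?thesis
      using LIMSEQ_subseq_LIMSEQ[OF r(2)[of x] r'] that by (simp add: o_def)
  qed
  then show ?case
    using strict_mono_o[OF r(1) r'] by blast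
qed

text \<open>A finite-dimensional space of functions is closed under pointwise limits. The
  coefficients \<open>W n\<close> themselves may diverge when the \<open>h i\<close> are linearly
  dependent, so they cannot simply be passed to the limit. The induction on \<open>S\<close> treats
  separately whether the new function \<open>h j\<close> already lies in the span of the
  others.\<close>

lemma finite_span_seq_closed:
  fixes h :: "'i \<Rightarrow> 'x \<Rightarrow> real"
  assumes "finite S" and "\<And>x. x \<in> X \<Longrightarrow> (\<lambda>n. \<Sum>i\<in>S. W n i * h i x) \<longlonglongrightarrow> u x"
  shows "\<exists>w. \<forall>x\<in>X. u x = (\<Sum>i\<in>S. w i * h i x)"
  using assms
proof (induction S arbitrary: W u rule: finite_induct)
  case empty
  then show ?case by (simp add: LIMSEQ_const_iff)
next
  case (insert j S)
  have upd: "(\<Sum>i\<in>insert j S. (w(j := c)) i * h i x) = c * h j x + (\<Sum>i\<in>S. w i * h i x)"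
    for w c x
  proof -
    have "(\<Sum>i\<in>S. (w(j := c)) i * h i x) = (\<Sum>i\<in>S. w i * h i x)"
      by (rule sum.cong) (use insert.hyps in auto)
    then show ?thesis using insert.hyps by simp
  qed
  have lim: "(\<lambda>n. W n j * h j x + (\<Sum>i\<in>S. W n i * h i x)) \<longlonglongrightarrow> u x" if "x \<in> X" for x
    using insert.prems[OF that] insert.hyps by simp
  show ?case
  proof (cases "\<exists>w. \<forall>x\<in>X. h j x = (\<Sum>i\<in>S. w i * h i x)")
    case True
    then obtain w0 where w0: "\<And>x. x \<in> X \<Longrightarrow> h j x = (\<Sum>i\<in>S. w0 i * h i x)" by auto
    \<comment> \<open>The dependent \<open>h j\<close> is absorbed into the coefficients over
      \<open>S\<close>; \<open>j\<close> then gets weight 0.\<close>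
    have "(\<lambda>n. \<Sum>i\<in>S. (W n j * w0 i + W n i) * h i x) \<longlonglongrightarrow> u x" if "x \<in> X" for x
      using lim[OF that] unfolding w0[OF that]
      by (simp add: sum.distrib sum_distrib_left algebra_simps)
    then obtain w where "\<forall>x\<in>X. u x = (\<Sum>i\<in>S. w i * h i x)"
      using insert.IH[of "\<lambda>n i. W n j * w0 i + W n i" u] by auto
    then have "\<forall>x\<in>X. u x = (\<Sum>i\<in>insert j S. (w(j := 0)) i * h i x)"
      unfolding upd by simp
    then show ?thesis by blast
  next
    case False
    \<comment> \<open>Rescaling by \<open>1 / (1 + \<bar>W n j\<bar>)\<close> bounds the coefficients of \<open>h j\<close>; the limit of the scaling
      factors cannot vanish, since otherwise \<open>h j\<close> would be a limit of elements of the span of \<open>S\<close>.\<close>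
    define s where "s n = 1 / (1 + \<bar>W n j\<bar>)" for n
    \<comment> \<open>Indexing both bounded sequences by a boolean lets one extraction over a
      two-point set yield a common subsequence.\<close>
    define v where "v n b = (if b then s n else W n j * s n)" for n b
    have s01: "0 < s n" "\<bar>s n\<bar> \<le> 1" "\<bar>W n j * s n\<bar> + s n = 1" for n
      unfolding s_def by (auto simp: abs_mult field_simps)
    have "norm (v n b) \<le> 1" for n b
      using s01[of n] by (auto simp: v_def)
    then have "Bseq (\<lambda>n. v n b)" for b
      by (intro BseqI'[where K = 1])
    then obtain r l where r: "strict_mono r" and l: "\<And>b. (\<lambda>n. v (r n) b) \<longlonglongrightarrow> l b"
      using Bseq_pointwise_convergent_subseq[of UNIV v] by auto
    have ls: "(\<lambda>n. s (r n)) \<longlonglongrightarrow> l True"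
      and lt: "(\<lambda>n. W (r n) j * s (r n)) \<longlonglongrightarrow> l False"
      using l[of True] l[of False] by (simp_all add: v_def)
    have "(\<lambda>n. \<bar>W (r n) j * s (r n)\<bar> + s (r n)) \<longlonglongrightarrow> \<bar>l False\<bar> + l True"
      by (intro tendsto_intros ls lt)
    \<comment> \<open>The normalization in \<open>s01\<close> survives the limit, so the two limits
      are not both zero.\<close>
    then have one: "\<bar>l False\<bar> + l True = 1"
      unfolding s01 by (simp add: LIMSEQ_const_iff)
    \<comment> \<open>Moving the scaled \<open>h j\<close> term to the limit side leaves
      combinations over \<open>S\<close> only, as the induction hypothesis demands.\<close>
    have "(\<lambda>n. \<Sum>i\<in>S. (s (r n) * W (r n) i) * h i x) \<longlonglongrightarrow> l True * u x - l False * h j x"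
      if "x \<in> X" for x
    proof -
      have "(\<lambda>n. W (r n) j * h j x + (\<Sum>i\<in>S. W (r n) i * h i x)) \<longlonglongrightarrow> u x"
        using LIMSEQ_subseq_LIMSEQ[OF lim[OF that] r] by (simp add: o_def)
      then have "(\<lambda>n. s (r n) * (W (r n) j * h j x + (\<Sum>i\<in>S. W (r n) i * h i x))
          - (W (r n) j * s (r n)) * h j x) \<longlonglongrightarrow> l True * u x - l False * h j x"
        by (intro tendsto_intros ls lt)
      then show ?thesis
        by (simp add: algebra_simps sum_distrib_left)
    qed
    then obtain w where w: "\<And>x. x \<in> X \<Longrightarrow> l True * u x - l False * h j x = (\<Sum>i\<in>S. w i * h i x)"
      using insert.IH[of "\<lambda>n i. s (r n) * W (r n) i" "\<lambda>x. l True * u x - l False * h j x"] by auto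
    have nz: "l True \<noteq> 0"
    proof
      assume z: "l True = 0"
      with one have f: "l False \<noteq> 0" by auto
      have "h j x = (\<Sum>i\<in>S. (- w i / l False) * h i x)" if "x \<in> X" for x
      proof -
        have "(\<Sum>i\<in>S. (- w i / l False) * h i x) = (- 1 / l False) * (\<Sum>i\<in>S. w i * h i x)"
          by (simp add: sum_distrib_left)
        then show ?thesis using w[OF that, symmetric] z f by simp
      qed
      then have "\<exists>w. \<forall>x\<in>X. h j x = (\<Sum>i\<in>S. w i * h i x)"
        by (intro exI[of _ "\<lambda>i. - w i / l False"]) simp
      with False show False by contradiction
    qed
    have "u x = (\<Sum>i\<in>insert j S. ((\<lambda>i. w i / l True)(j := l False / l True)) i * h i x)"
      if "x \<in> X" for x
    proof -
      have "(\<Sum>i\<in>S. (w i / l True) * h i x) = (\<Sum>i\<in>S. w i * h i x) / l True"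
        by (simp add: sum_divide_distrib)
      then show ?thesis unfolding upd using w[OF that, symmetric] nz by (simp add: field_simps)
    qed
    then show ?thesis by blast
  qed
qed

text \<open>Compactness is applied to the values of the functions \<open>U w\<close>, not to the
  weights: a minimizing sequence of weights can be unbounded, whereas its values are bounded at each
  point of \<open>X\<close>. Closedness of the span recovers weights from the limit
  function.\<close>

lemma sum_exp_span_attains_min:
  fixes h :: "'i \<Rightarrow> 'x \<Rightarrow> real"
  assumes "finite X" "finite S"
    and p: "\<And>x. x \<in> X \<Longrightarrow> 0 < p x" "sum p X = 1"
    and mean0: "\<And>i. i \<in> S \<Longrightarrow> (\<Sum>x\<in>X. h i x * p x) = 0"
  shows "\<exists>w. \<forall>v. (\<Sum>x\<in>X. exp (\<Sum>i\<in>S. w i * h i x)) \<le> (\<Sum>x\<in>X. exp (\<Sum>i\<in>S. v i * h i x))"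
proof -
  define U where "U w x = (\<Sum>i\<in>S. w i * h i x)" for w x
  define G where "G w = (\<Sum>x\<in>X. exp (U w x))" for w
  define m where "m = Inf (range G)"
  have G0: "G w \<ge> 0" for w unfolding G_def by (simp add: sum_nonneg)
  have bdd: "bdd_below (range G)" using G0 by (intro bdd_belowI[of _ 0]) auto
  have mle: "m \<le> G w" for w unfolding m_def by (rule cInf_lower[OF _ bdd]) simp
  have "\<exists>w. G w < m + 1 / real (Suc n)" for n
    using cInf_lessD[of "range G" "m + 1 / real (Suc n)"] by (auto simp: m_def)
  then obtain W where W: "\<And>n. G (W n) < m + 1 / real (Suc n)" by metis
  have Um: "(\<Sum>x\<in>X. U w x * p x) = 0" for w
  proof -
    have "(\<Sum>x\<in>X. U w x * p x) = (\<Sum>x\<in>X. \<Sum>i\<in>S. w i * (h i x * p x))"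
      by (simp add: U_def sum_distrib_right mult.assoc)
    also have "\<dots> = (\<Sum>i\<in>S. w i * (\<Sum>x\<in>X. h i x * p x))"
      by (subst sum.swap) (simp add: sum_distrib_left)
    finally show ?thesis using mean0 by simp
  qed
  \<comment> \<open>The chosen sequence satisfies \<open>G (W n) \<le> m + 1\<close>, and each
    single exponential is at most the whole sum.\<close>
  define M where "M = ln (m + 1)"
  have m0: "m \<ge> 0" unfolding m_def by (rule cInf_greatest) (auto simp: G0)
  have M0: "M \<ge> 0" using m0 by (simp add: M_def)
  have up: "U (W n) x \<le> M" if "x \<in> X" for n x
  proof -
    have "exp (U (W n) x) \<le> G (W n)"
      unfolding G_def by (rule member_le_sum) (use that assms in auto)
    also have "\<dots> \<le> m + 1"
    proof -
      have "1 / real (Suc n) \<le> 1" by simp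
      then show ?thesis using W[of n] by linarith
    qed
    finally show ?thesis
      unfolding M_def using m0 by (simp add: ln_ge_iff)
  qed
  have low: "- (M / p x) \<le> U (W n) x" if "x \<in> X" for n x
  proof -
    \<comment> \<open>The mean is zero, so the weighted value at \<open>x\<close> is balanced by the
      remaining points, which contribute at most \<open>M\<close> in total.\<close>
    have "- (U (W n) x * p x) = (\<Sum>y\<in>X - {x}. U (W n) y * p y)"
      using Um[of "W n"] sum.remove[OF assms(1) that, of "\<lambda>y. U (W n) y * p y"] by simp
    also have "\<dots> \<le> (\<Sum>y\<in>X - {x}. M * p y)"
      by (rule sum_mono) (use up p(1) in \<open>auto intro!: mult_right_mono less_imp_le\<close>)
    also have "\<dots> \<le> (\<Sum>y\<in>X. M * p y)"
      by (rule sum_mono2) (use assms(1) M0 less_imp_le[OF p(1)] in auto)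
    also have "\<dots> = M" using p(2) by (simp flip: sum_distrib_left)
    finally show ?thesis using p(1)[OF that] by (simp add: field_simps)
  qed
  have "Bseq (\<lambda>n. U (W n) x)" if "x \<in> X" for x
  proof (rule BseqI'[where K = "M + M / p x"])
    fix n
    have "M / p x \<ge> 0" using M0 p(1)[OF that] by simp
    then show "norm (U (W n) x) \<le> M + M / p x"
      using up[OF that, of n] low[OF that, of n] M0 by (auto simp: abs_le_iff)
  qed
  then obtain r l where r: "strict_mono r" and l: "\<And>x. x \<in> X \<Longrightarrow> (\<lambda>n. U (W (r n)) x) \<longlonglongrightarrow> l x"
    using Bseq_pointwise_convergent_subseq[OF assms(1), of "\<lambda>n. U (W n)"] by auto
  then obtain w where w: "\<And>x. x \<in> X \<Longrightarrow> l x = U w x"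
    using finite_span_seq_closed[OF assms(2), of X "\<lambda>n. W (r n)" h l] by (auto simp: U_def)
  have "(\<lambda>n. G (W (r n))) \<longlonglongrightarrow> G w"
    unfolding G_def by (intro tendsto_intros) (use l w in auto)
  moreover have "(\<lambda>n. m + 1 / real (Suc (r n))) \<longlonglongrightarrow> m + 0"
    using LIMSEQ_subseq_LIMSEQ[OF LIMSEQ_inverse_real_of_nat r]
    by (intro tendsto_intros) (simp add: o_def inverse_eq_divide)
  ultimately have "G w \<le> m + 0"
    by (rule LIMSEQ_le) (use W in \<open>auto intro: less_imp_le\<close>)
  then have "G w \<le> G v" for v using mle[of v] by simp
  then show ?thesis unfolding G_def U_def by blast
qed

section \<open>The dual objective: existence of a maximizer and stationarity\<close>

text \<open>Centering each \<open>f i\<close> at its mean \<open>q i\<close> absorbs the linear term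
  into the exponentials, so the objective becomes minus the logarithm of a sum that attains its
  minimum.\<close>

lemma log_partition_dual_attains_max:
  fixes f :: "'i \<Rightarrow> 'x \<Rightarrow> real"
  assumes "finite X" "finite S"
    and p: "\<And>x. x \<in> X \<Longrightarrow> 0 < p x" "sum p X = 1"
    and q: "\<And>i. i \<in> S \<Longrightarrow> (\<Sum>x\<in>X. f i x * p x) = q i"
  shows "\<exists>w. \<forall>v. (\<Sum>i\<in>S. v i * q i) - ln (\<Sum>x\<in>X. exp (\<Sum>i\<in>S. v i * f i x)) \<le>
    (\<Sum>i\<in>S. w i * q i) - ln (\<Sum>x\<in>X. exp (\<Sum>i\<in>S. w i * f i x))"
proof -
  have X: "X \<noteq> {}" using p(2) by auto
  have "(\<Sum>x\<in>X. (f i x - q i) * p x) = 0" if "i \<in> S" for i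
    using q[OF that] p(2) by (simp add: left_diff_distrib sum_subtractf flip: sum_distrib_left)
  then obtain w where w: "\<And>v. (\<Sum>x\<in>X. exp (\<Sum>i\<in>S. w i * (f i x - q i)))
      \<le> (\<Sum>x\<in>X. exp (\<Sum>i\<in>S. v i * (f i x - q i)))"
    using sum_exp_span_attains_min[OF assms(1,2) p, of "\<lambda>i x. f i x - q i"] by auto
  have pos: "0 < (\<Sum>x\<in>X. exp (g x :: real))" for g
    by (rule sum_pos) (use assms(1) X in auto)
  have eq: "(\<Sum>i\<in>S. v i * q i) - ln (\<Sum>x\<in>X. exp (\<Sum>i\<in>S. v i * f i x)) =
      - ln (\<Sum>x\<in>X. exp (\<Sum>i\<in>S. v i * (f i x - q i)))" for v
  proof -
    have "(\<Sum>x\<in>X. exp (\<Sum>i\<in>S. v i * (f i x - q i))) =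
        (\<Sum>x\<in>X. exp (\<Sum>i\<in>S. v i * f i x)) / exp (\<Sum>i\<in>S. v i * q i)"
      by (simp add: right_diff_distrib sum_subtractf exp_diff sum_divide_distrib)
    then show ?thesis
      using pos[of "\<lambda>x. \<Sum>i\<in>S. v i * f i x"] by (simp add: ln_div)
  qed
  show ?thesis
    unfolding eq using w pos by (intro exI[of _ w]) simp
qed

text \<open>Varying only the weight at \<open>j\<close> reduces the claim to the vanishing
  derivative of a one-variable function at its maximum; the quotient is the mean of
  \<open>f j\<close> under the exponential distribution.\<close>

lemma log_partition_dual_stationary:
  fixes f :: "'i \<Rightarrow> 'x \<Rightarrow> real"
  assumes "finite X" "X \<noteq> {}" "finite S" "j \<in> S"
    and max: "\<And>v. (\<Sum>i\<in>S. v i * q i) - ln (\<Sum>x\<in>X. exp (\<Sum>i\<in>S. v i * f i x)) \<le>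
      (\<Sum>i\<in>S. w i * q i) - ln (\<Sum>x\<in>X. exp (\<Sum>i\<in>S. w i * f i x))"
  shows "(\<Sum>x\<in>X. f j x * exp (\<Sum>i\<in>S. w i * f i x)) / (\<Sum>x\<in>X. exp (\<Sum>i\<in>S. w i * f i x)) = q j"
proof -
  have upd: "(\<Sum>i\<in>S. (w(j := w j + t)) i * g i) = (\<Sum>i\<in>S. w i * g i) + t * g j" for t g
  proof -
    have "(\<Sum>i\<in>S - {j}. (w(j := w j + t)) i * g i) = (\<Sum>i\<in>S - {j}. w i * g i)"
      by (rule sum.cong) auto
    then show ?thesis
      using assms(3,4) by (simp add: sum.remove[of S j] distrib_right)
  qed
  have pos: "0 < (\<Sum>x\<in>X. exp (g x :: real))" for g
    by (rule sum_pos) (use assms(1,2) in auto)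
  define D where "D t = (\<Sum>i\<in>S. w i * q i) + t * q j
    - ln (\<Sum>x\<in>X. exp ((\<Sum>i\<in>S. w i * f i x) + t * f j x))" for t
  define d where "d = q j -
    (\<Sum>x\<in>X. f j x * exp (\<Sum>i\<in>S. w i * f i x)) / (\<Sum>x\<in>X. exp (\<Sum>i\<in>S. w i * f i x))"
  have "(D has_real_derivative d) (at 0)"
    unfolding D_def d_def
    by (rule derivative_eq_intros refl | simp add: pos)+
       (simp add: mult.commute field_simps)
  moreover have "D t \<le> D 0" for t
    using max[of "w(j := w j + t)"] unfolding upd D_def by simp
  \<comment> \<open>The maximum at 0 is global, so the radius 1 is an arbitrary choice.\<close>
  ultimately have "d = 0"
    using DERIV_local_max[of D d 0 1] by simp
  then show ?thesis by (simp add: d_def)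
qed

text \<open>Gibbs' inequality, obtained by summing the pointwise consequence of
  \<open>ln y \<le> y - 1\<close> at \<open>y = P x / R x\<close>; points with
  \<open>R x = 0\<close> are handled apart.\<close>

lemma entropy_le_cross_entropy:
  fixes P R :: "'x \<Rightarrow> real"
  assumes "\<And>x. x \<in> X \<Longrightarrow> 0 < P x" "\<And>x. x \<in> X \<Longrightarrow> 0 \<le> R x" and "sum P X = sum R X"
  shows "(\<Sum>x\<in>X. R x * ln (1 / R x)) \<le> (\<Sum>x\<in>X. R x * ln (1 / P x))"
proof -
  have "R x * ln (1 / R x) - R x * ln (1 / P x) \<le> P x - R x" if "x \<in> X" for x
  proof (cases "R x = 0")
    case True
    then show ?thesis using assms(1)[OF that] by simp
  next
    case False
    then have R: "0 < R x" using assms(2)[OF that] by simp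
    note P = assms(1)[OF that]
    have "R x * ln (1 / R x) - R x * ln (1 / P x) = R x * ln (P x / R x)"
      using R P by (simp add: ln_div algebra_simps)
    also have "\<dots> \<le> R x * (P x / R x - 1)"
      using R P by (intro mult_left_mono ln_le_minus_one) auto
    also have "\<dots> = P x - R x" using R by (simp add: field_simps)
    finally show ?thesis .
  qed
  then have "(\<Sum>x\<in>X. R x * ln (1 / R x) - R x * ln (1 / P x)) \<le> (\<Sum>x\<in>X. P x - R x)"
    by (rule sum_mono)
  then show ?thesis using assms(3) by (simp add: sum_subtractf)
qed

section \<open>Application to possible worlds and relational marginals\<close>

lemma finite_worlds:
  assumes "finite \<sigma>" "finite \<Delta>"
  shows "finite (worlds \<sigma> ar \<Delta>)"
proof -
  have "{(p, as). p \<in> \<sigma> \<and> length as = ar p \<and> set as \<subseteq> \<Delta>} =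
      (SIGMA p:\<sigma>. {as. set as \<subseteq> \<Delta> \<and> length as = ar p})" by auto
  then show ?thesis
    unfolding worlds_def using assms by (simp add: finite_lists_length_eq)
qed

text \<open>The logarithm of the exponential distribution is a constant plus a combination of the
  constrained statistics, and feasibility fixes the means of these. Hence the cross entropy is the
  same for every feasible \<open>R\<close>.\<close>

lemma cross_entropy_exponential_distribution:
  assumes "finite \<Omega>" "\<Omega> \<noteq> {}" "feasible \<Delta> C \<Omega> R"
  shows "(\<Sum>\<omega>\<in>\<Omega>. R \<omega> * ln (1 / exponential_distribution \<Delta> C \<Omega> w \<omega>)) = - weight_objective \<Delta> C \<Omega> w"
proof -
  let ?Z = "\<Sum>\<omega>\<in>\<Omega>. exp (weighted_stat \<Delta> C w \<omega>)"
  have Z: "?Z > 0" by (rule sum_pos) (use assms in auto)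
  have ws: "(\<Sum>\<omega>\<in>\<Omega>. R \<omega> * weighted_stat \<Delta> C w \<omega>) = (\<Sum>(\<alpha>, q)\<in>soft C. w (\<alpha>, q) * q)"
  proof -
    have "(\<Sum>\<omega>\<in>\<Omega>. R \<omega> * weighted_stat \<Delta> C w \<omega>) =
        (\<Sum>\<omega>\<in>\<Omega>. \<Sum>(\<alpha>, q)\<in>soft C. w (\<alpha>, q) * (stat \<Delta> \<omega> \<alpha> * R \<omega>))"
      by (simp add: weighted_stat_def sum_distrib_left case_prod_unfold algebra_simps)
    also have "\<dots> = (\<Sum>(\<alpha>, q)\<in>soft C. w (\<alpha>, q) * (\<Sum>\<omega>\<in>\<Omega>. stat \<Delta> \<omega> \<alpha> * R \<omega>))"
      by (subst sum.swap) (simp add: sum_distrib_left case_prod_unfold)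
    also have "\<dots> = (\<Sum>(\<alpha>, q)\<in>soft C. w (\<alpha>, q) * q)"
      by (rule sum.cong) (use assms(3) in \<open>auto simp: feasible_def\<close>)
    finally show ?thesis .
  qed
  have "ln (1 / exponential_distribution \<Delta> C \<Omega> w \<omega>) = ln ?Z - weighted_stat \<Delta> C w \<omega>" for \<omega>
    using Z by (simp add: exponential_distribution_def ln_div)
  then have "(\<Sum>\<omega>\<in>\<Omega>. R \<omega> * ln (1 / exponential_distribution \<Delta> C \<Omega> w \<omega>)) =
      (\<Sum>\<omega>\<in>\<Omega>. R \<omega>) * ln ?Z - (\<Sum>\<omega>\<in>\<Omega>. R \<omega> * weighted_stat \<Delta> C w \<omega>)"
    by (simp add: right_diff_distrib sum_subtractf sum_distrib_right)
  then show ?thesis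
    using assms(3) unfolding ws by (simp add: feasible_def weight_objective_def)
qed

theorem mainTheorem6:
  fixes \<sigma> :: "'p set" and ar :: "'p \<Rightarrow> nat"
    and Cs \<Delta> :: "'a set"
    and C :: "('p, 'a) constr set"
    and \<Omega> :: "('p, 'a) world set"
  assumes "finite \<sigma>"
    and "finite \<Delta>" and "\<Delta> \<noteq> {}"
    and "finite Cs" and "Cs \<subseteq> \<Delta>"
    and "finite C"
    and "\<And>\<alpha> q. (\<alpha>, q) \<in> C \<Longrightarrow> quantified_sentence \<sigma> ar Cs \<alpha> \<and> 0 \<le> q \<and> q \<le> 1"
    and "\<Omega> = admissible_worlds \<sigma> ar \<Delta> C"
    and "\<exists>P. feasible \<Delta> C \<Omega> P \<and> (\<forall>\<omega>\<in>\<Omega>. P \<omega> > 0)"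
  shows "(\<exists>w. is_arg_max (weight_objective \<Delta> C \<Omega>) (\<lambda>_. True) w) \<and>
    (\<forall>w. is_arg_max (weight_objective \<Delta> C \<Omega>) (\<lambda>_. True) w \<longrightarrow>
      is_arg_max (entropy \<Omega>) (feasible \<Delta> C \<Omega>) (exponential_distribution \<Delta> C \<Omega> w))"
proof -
  let ?f = "\<lambda>c \<omega>. stat \<Delta> \<omega> (fst c)"
  let ?E = "exponential_distribution \<Delta> C \<Omega>"
  obtain P where P: "feasible \<Delta> C \<Omega> P" "\<And>\<omega>. \<omega> \<in> \<Omega> \<Longrightarrow> 0 < P \<omega>"
    using assms(9) by auto
  have fin: "finite \<Omega>"
    unfolding assms(8) admissible_worlds_def using finite_worlds[OF assms(1,2)] by simp
  have ne: "\<Omega> \<noteq> {}" using P(1) by (auto simp: feasible_def)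
  have finS: "finite (soft C)"
    by (rule finite_subset[OF _ assms(6)]) (auto simp: soft_def)
  \<comment> \<open>The generic lemmas are used with the soft constraints themselves as indices:
    \<open>fst c\<close> supplies the statistic and \<open>snd c\<close> its target.\<close>
  have obj: "weight_objective \<Delta> C \<Omega> =
      (\<lambda>w. (\<Sum>c\<in>soft C. w c * snd c) - ln (\<Sum>\<omega>\<in>\<Omega>. exp (\<Sum>c\<in>soft C. w c * ?f c \<omega>)))"
    by (simp add: fun_eq_iff weight_objective_def weighted_stat_def case_prod_unfold)
  have "\<exists>w. \<forall>v. weight_objective \<Delta> C \<Omega> v \<le> weight_objective \<Delta> C \<Omega> w"
    unfolding obj
    by (rule log_partition_dual_attains_max[OF fin finS P(2)]) (use P(1) in \<open>auto simp: feasible_def\<close>)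
  then have ex: "\<exists>w. is_arg_max (weight_objective \<Delta> C \<Omega>) (\<lambda>_. True) w"
    by (simp add: is_arg_max_def not_less)
  have opt: "is_arg_max (entropy \<Omega>) (feasible \<Delta> C \<Omega>) (?E w)"
    if "is_arg_max (weight_objective \<Delta> C \<Omega>) (\<lambda>_. True) w" for w
  proof -
    let ?Z = "\<Sum>\<omega>\<in>\<Omega>. exp (weighted_stat \<Delta> C w \<omega>)"
    have Z: "?Z > 0" by (rule sum_pos) (use fin ne in auto)
    have Epos: "0 < ?E w \<omega>" for \<omega>
      using Z by (simp add: exponential_distribution_def)
    have Esum: "(\<Sum>\<omega>\<in>\<Omega>. ?E w \<omega>) = 1"
      using Z by (simp add: exponential_distribution_def flip: sum_divide_distrib)
    have "weight_objective \<Delta> C \<Omega> v \<le> weight_objective \<Delta> C \<Omega> w" for v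
      using that by (simp add: is_arg_max_def not_less)
    then have "(\<Sum>\<omega>\<in>\<Omega>. ?f c \<omega> * exp (weighted_stat \<Delta> C w \<omega>)) / ?Z = snd c" if "c \<in> soft C" for c
      unfolding weighted_stat_def case_prod_unfold obj prod.collapse
      by (intro log_partition_dual_stationary[OF fin ne finS that])
    then have "(\<Sum>\<omega>\<in>\<Omega>. ?f c \<omega> * ?E w \<omega>) = snd c" if "c \<in> soft C" for c
      using that by (simp add: exponential_distribution_def sum_divide_distrib)
    then have feasE: "feasible \<Delta> C \<Omega> (?E w)"
      using Esum Epos by (force simp: feasible_def intro: less_imp_le)
    have "entropy \<Omega> R \<le> entropy \<Omega> (?E w)" if R: "feasible \<Delta> C \<Omega> R" for R
    proof -
      have "entropy \<Omega> R \<le> (\<Sum>\<omega>\<in>\<Omega>. R \<omega> * ln (1 / ?E w \<omega>))"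
        unfolding entropy_def
        by (rule entropy_le_cross_entropy) (use R Epos Esum in \<open>auto simp: feasible_def\<close>)
      \<comment> \<open>As \<open>?E w\<close> is feasible too, its entropy, being its cross entropy
        with itself, equals the cross entropy of \<open>R\<close>.\<close>
      also have "\<dots> = entropy \<Omega> (?E w)"
        unfolding entropy_def cross_entropy_exponential_distribution[OF fin ne R]
          cross_entropy_exponential_distribution[OF fin ne feasE] ..
      finally show ?thesis .
    qed
    then show ?thesis using feasE by (auto simp: is_arg_max_def not_less)
  qed
  show ?thesis using ex opt by blast
qed

end
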